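(* Let $p\in[0,1)$, $q=1-p$, $\bar g=\{g_j\}_{j\in\mathbb N}\in\mathbb R^\infty$, and let $\{X^{(1)}_j\}_{j\in\mathbb N}$, $\{X^{(2)}_j\}_{j\in\mathbb N}$ be two infinite systems of competing Brownian particles with parameters $p,\bar g$, with a common initial condition $\bar x$ and common driving Brownian motions $\{B_j\}$, given on some filtered probability space $(\Omega,\mathcal F,\{\mathcal F_t\}_{t\ge0},\mathbb P)$. Suppose that either (a) for all $i\in\mathbb N$ and $T\in(0,\infty)$, $K^*(i,[0,T],\{X^{(l)}_j\})<\infty$ a.s. for $l=1,2$; or (b) there exists a strictly positive $\mathcal F_0$-measurable random variable $\Delta$ such that for all $i\in\mathbb N$ and $T\in[0,\infty)$, $K^*(i,[T,T+\Delta],\{X^{(l)}_j\})<\infty$ a.s. for $l=1,2$. Then, a.s., $X^{(1)}_j(t)=X^{(2)}_j(t)$ for all $t\ge0$ and $j\in\mathbb N$.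
   Context: Setting. $(\Omega,\mathcal F,\{\mathcal F_t\}_{t\ge0},\mathbb P)$ is a filtered probability space carrying independent standard one-dimensional ($\mathcal F_t$-adapted) Brownian motions $\{B_j\}_{j\in\mathbb N}$ such that $\{B_i(t+\cdot)-B_i(t),\,i\in\mathbb N\}$ is independent of $\mathcal F_t$ for all $t\ge0$, and $\bar x=\{x_j\}_{j\in\mathbb N}$ is a non-decreasing sequence of real $\mathcal F_0$-measurable random variables (initial conditions). An infinite system of competing Brownian particles (a solution) with parameters $p,\bar g$, initial conditions $\bar x$ and driving Brownian motions $\{B_j\}$ is a collection $\{X_j\}_{j\in\mathbb N}$ of continuous, real-valued, $\{\mathcal F_t\}$-adapted processes for which there are continuous, real-valued, $\{\mathcal F_t\}$-adapted processes $\{L_{(j,j+1)}\}_{j\ge0}$ (the associated local times) such that: (P1) for all $t\ge0$, $j\in\mathbb N$: $X_j(t)=x_j+g_jt+B_j(t)+pL_{(j-1,j)}(t)-qL_{(j,j+1)}(t)$; (P2) for all $t\ge0$ the sequence $\{X_j(t)\}_{j\in\mathbb N}$ is non-decreasing; (P3) $L_{(0,1)}\equiv0$, and for $j\ge1$, $L_{(j,j+1)}$ is non-decreasing with $L_{(j,j+1)}(0)=0$ and $\int_0^\infty(X_{j+1}(t)-X_j(t))\,dL_{(j,j+1)}(t)=0$. Collision chains. For $i\in\mathbb N$ and $0\le u<v<\infty$, $K^*(i,[u,v],\{X_j\})=\sup\{k\ge0:\exists\,u\le s_{i+k-1}\le\cdots\le s_{i+1}\le s_i\le v$ such that $X_{j+1}(s_j)=X_j(s_j)$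 for $i\le j\le i+k-1\}\in\{0,1,2,\dots\}\cup\{\infty\}$ (for $k=0$ the condition is vacuous). *)

theory Defs
  imports "HOL-Probability.Probability"
begin

text \<open>
  Particles carry the indices \<open>1, 2, \<dots>\<close> and time runs through \<open>[0, \<infinity>)\<close>; values at index 0
  (except for the local times, where \<open>L 0\<close> is \<open>L\<^sub>(\<^sub>0\<^sub>,\<^sub>1\<^sub>)\<close>) and at negative times are junk and are
  never constrained. A process is a function of time and then of the sample point.
  All path properties are required almost surely only.
\<close>

text \<open>The library locale \<open>filtration\<close> is indexed by a whole type, so it would impose a filtration on
  negative times as well.\<close>

locale filtered_prob_space = prob_space M for M :: "'a measure" +
  fixes F :: "real \<Rightarrow> 'a measure"
  assumes subalgebra_filtration: "0 \<le> t \<Longrightarrow> subalgebra M (F t)"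
    and filtration_mono: "0 \<le> s \<Longrightarrow> s \<le> t \<Longrightarrow> subalgebra (F t) (F s)"

definition adapted :: "(real \<Rightarrow> 'a measure) \<Rightarrow> (real \<Rightarrow> 'a \<Rightarrow> real) \<Rightarrow> bool" where
  "adapted F X \<longleftrightarrow> (\<forall>t\<ge>0. X t \<in> borel_measurable (F t))"

definition continuous_process :: "'a measure \<Rightarrow> (real \<Rightarrow> 'a \<Rightarrow> real) \<Rightarrow> bool" where
  "continuous_process M X \<longleftrightarrow> (AE \<omega> in M. continuous_on {0..} (\<lambda>t. X t \<omega>))"

definition (in prob_space) standard_brownian_motion :: "(real \<Rightarrow> 'a \<Rightarrow> real) \<Rightarrow> bool" where
  "standard_brownian_motion B \<longleftrightarrow>
     (\<forall>t\<ge>0. B t \<in> borel_measurable M) \<and>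
     (AE \<omega> in M. B 0 \<omega> = 0) \<and>
     continuous_process M B \<and>
     (\<forall>s t. 0 \<le> s \<longrightarrow> s < t \<longrightarrow>
        distributed M lborel (\<lambda>\<omega>. B t \<omega> - B s \<omega>) (normal_density 0 (sqrt (t - s)))) \<and>
     (\<forall>(\<tau> :: nat \<Rightarrow> real) n. 0 \<le> \<tau> 0 \<longrightarrow> (\<forall>k<n. \<tau> k < \<tau> (Suc k)) \<longrightarrow>
        indep_vars (\<lambda>_. borel) (\<lambda>k \<omega>. B (\<tau> (Suc k)) \<omega> - B (\<tau> k) \<omega>) {..<n})"

text \<open>Independence of whole processes is independence of the path-valued random variables, with
  respect to the product sigma-algebra on the path space.\<close>

locale cbp_setting = filtered_prob_space M F
  for M :: "'a measure" and F :: "real \<Rightarrow> 'a measure" +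
  fixes B :: "nat \<Rightarrow> real \<Rightarrow> 'a \<Rightarrow> real"
    and x :: "nat \<Rightarrow> 'a \<Rightarrow> real"
  assumes brownian: "1 \<le> j \<Longrightarrow> standard_brownian_motion (B j)"
    and brownian_adapted: "1 \<le> j \<Longrightarrow> adapted F (B j)"
    and brownian_indep:
      "indep_vars (\<lambda>_. \<Pi>\<^sub>M t\<in>{0..}. borel) (\<lambda>j \<omega>. \<lambda>t\<in>{0..}. B j t \<omega>) {1..}"
    and increments_indep: "0 \<le> t \<Longrightarrow>
      indep_set (sets (F t))
        (sets (vimage_algebra (space M)
          (\<lambda>\<omega>. \<lambda>(j, s)\<in>{1..} \<times> {0..}. B j (t + s) \<omega> - B j t \<omega>)
          (\<Pi>\<^sub>M js\<in>{1::nat..} \<times> {0::real..}. borel)))"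
    and initial_measurable: "1 \<le> j \<Longrightarrow> x j \<in> borel_measurable (F 0)"
    and initial_mono: "AE \<omega> in M. mono_on {1..} (\<lambda>j. x j \<omega>)"

text \<open>Here \<open>L j\<close> is \<open>L\<^sub>(\<^sub>j\<^sub>,\<^sub>j\<^sub>+\<^sub>1\<^sub>)\<close> and \<open>q = 1 - p\<close>. The Lebesgue-Stieltjes measure \<open>dL\<close> on \<open>[0, \<infinity>)\<close>
  is obtained by extending the path of \<open>L\<close> to negative times by its value at 0. As the gap
  is non-negative, its integral is a Lebesgue integral with values in \<open>[0, \<infinity>]\<close>; the Bochner
  integral would be 0 also for a non-integrable gap.\<close>

definition local_times ::
  "'a measure \<Rightarrow> (real \<Rightarrow> 'a measure) \<Rightarrow> real \<Rightarrow> (nat \<Rightarrow> real) \<Rightarrow> (nat \<Rightarrow> 'a \<Rightarrow> real) \<Rightarrow>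
   (nat \<Rightarrow> real \<Rightarrow> 'a \<Rightarrow> real) \<Rightarrow> (nat \<Rightarrow> real \<Rightarrow> 'a \<Rightarrow> real) \<Rightarrow> (nat \<Rightarrow> real \<Rightarrow> 'a \<Rightarrow> real) \<Rightarrow> bool"
where
  "local_times M F p g x B X L \<longleftrightarrow>
     (\<forall>j. continuous_process M (L j) \<and> adapted F (L j)) \<and>
     (AE \<omega> in M. \<forall>t\<ge>0. \<forall>j\<ge>1.
        X j t \<omega> = x j \<omega> + g j * t + B j t \<omega> + p * L (j - 1) t \<omega> - (1 - p) * L j t \<omega>) \<and>
     (AE \<omega> in M. \<forall>t\<ge>0. L 0 t \<omega> = 0) \<and>
     (AE \<omega> in M. \<forall>j\<ge>1. mono_on {0..} (\<lambda>t. L j t \<omega>) \<and> L j 0 \<omega> = 0) \<and>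
     (AE \<omega> in M. \<forall>j\<ge>1.
        (\<integral>\<^sup>+t\<in>{0..}. ennreal (X (j + 1) t \<omega> - X j t \<omega>)
           \<partial>interval_measure (\<lambda>t. L j (max 0 t) \<omega>)) = 0)"

definition competing_brownian_particles ::
  "'a measure \<Rightarrow> (real \<Rightarrow> 'a measure) \<Rightarrow> real \<Rightarrow> (nat \<Rightarrow> real) \<Rightarrow> (nat \<Rightarrow> 'a \<Rightarrow> real) \<Rightarrow>
   (nat \<Rightarrow> real \<Rightarrow> 'a \<Rightarrow> real) \<Rightarrow> (nat \<Rightarrow> real \<Rightarrow> 'a \<Rightarrow> real) \<Rightarrow> bool"
where
  "competing_brownian_particles M F p g x B X \<longleftrightarrow>
     (\<forall>j\<ge>1. continuous_process M (X j) \<and> adapted F (X j)) \<and>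
     (AE \<omega> in M. \<forall>t\<ge>0. mono_on {1..} (\<lambda>j. X j t \<omega>)) \<and>
     (\<exists>L. local_times M F p g x B X L)"

definition Kstar :: "nat \<Rightarrow> real set \<Rightarrow> (nat \<Rightarrow> real \<Rightarrow> real) \<Rightarrow> enat" where
  "Kstar i I X = Sup {enat k |k. \<exists>s :: nat \<Rightarrow> real.
     antimono_on {i..<i + k} s \<and>
     (\<forall>j\<in>{i..<i + k}. s j \<in> I \<and> X (j + 1) (s j) = X j (s j))}"

end

theory Submission
  imports Defs
begin

text \<open>
  Uniqueness is a pathwise fact. Subtracting the equations of two solutions \<open>X\<close>, \<open>Y\<close> with local
  times \<open>L\<close>, \<open>M\<close> removes the Brownian motions: \<open>D\<^sub>j = Y\<^sub>j - X\<^sub>j\<close> equals \<open>p N\<^sub>j\<^sub>-\<^sub>1 - q N\<^sub>j\<close> with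
  \<open>N = M - L\<close>, which is continuous and of finite variation.

  The heart is a comparison principle (\<open>comparison\<close>): if the \<open>n\<close> lowest particles of \<open>X\<close> receive no
  push from above during \<open>[a, b]\<close>, that is, if \<open>L\<^sub>n\<close> is constant there, and if \<open>Y\<^sub>j \<le> X\<^sub>j\<close> for
  \<open>j \<le> n\<close> at time \<open>a\<close>, then this order persists until \<open>b\<close>. Indeed \<open>M\<^sub>j\<close> grows only when
  \<open>Y\<^sub>j = Y\<^sub>j\<^sub>+\<^sub>1\<close>, and then \<open>D\<^sub>j\<^sub>+\<^sub>1 \<le> D\<^sub>j\<close>; \<open>L\<^sub>j\<close> grows only when \<open>X\<^sub>j = X\<^sub>j\<^sub>+\<^sub>1\<close>, and then
  \<open>D\<^sub>j \<le> D\<^sub>j\<^sub>+\<^sub>1\<close>. The weights \<open>\<pi>\<^sub>j = q\<^sup>j p\<^sup>m\<^sup>-\<^sup>j\<close> satisfy \<open>p \<pi>\<^sub>j\<^sub>+\<^sub>1 = q \<pi>\<^sub>j\<close>, so that by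
  summation by parts the energy \<open>\<Sum>\<^sub>j \<pi>\<^sub>j (D\<^sub>j\<^sup>+)\<^sup>2\<close> over \<open>j \<le> m\<close> has the differential
  \<open>2 \<Sum>\<^sub>j\<^sub><\<^sub>m q \<pi>\<^sub>j (D\<^sub>j\<^sub>+\<^sub>1\<^sup>+ - D\<^sub>j\<^sup>+) d(M\<^sub>j - L\<^sub>j) - 2 q \<pi>\<^sub>m D\<^sub>m\<^sup>+ d(M\<^sub>m - L\<^sub>m)\<close>. The sum is
  non-positive, and so is the boundary term for \<open>m = n\<close>, as \<open>L\<^sub>n\<close> is constant. The energy starts at 0
  and therefore vanishes.

  Finiteness of collision chains supplies intervals without a push from above
  (\<open>comparison_without_chain\<close>). Let \<open>\<tau>\<close> be the last collision of particles \<open>i\<close> and \<open>i + 1\<close> of \<open>X\<close> in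
  \<open>[a, b]\<close>. Chains from \<open>i + 1\<close> in \<open>[a, \<tau>]\<close> are shorter by one than those from \<open>i\<close> in \<open>[a, b]\<close>, so by
  induction \<open>Y\<^sub>j \<le> X\<^sub>j\<close> holds for \<open>j \<le> i + 1\<close> at \<open>\<tau>\<close>; on \<open>[\<tau>, b]\<close> the \<open>i\<close> lowest particles
  of \<open>X\<close> are left alone, and the comparison principle leads to time \<open>b\<close>. Exchanging the roles of
  \<open>X\<close> and \<open>Y\<close> gives equality.

  The hypothesis of a uniform window \<open>\<Delta>\<close> is used at the countably many rational left endpoints, where
  it holds simultaneously almost surely; windows of length \<open>\<Delta>\<close> then cover the half-line. Finiteness
  on all \<open>[0, T]\<close> yields such windows with \<open>\<Delta> = 1\<close>.
\<close>

section \<open>A chain rule inequality for paths of finite variation\<close>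

text \<open>
  The energy \<open>\<Phi> = \<Sum>\<^sub>j \<pi>\<^sub>j (D\<^sub>j\<^sup>+)\<^sup>2\<close> does not increase if its formal differential is non-positive.
  Convexity of the squared positive part bounds an increment of \<open>\<Phi>\<close> over a short interval around \<open>y\<close>
  by the differential frozen at \<open>y\<close>, up to \<open>\<epsilon>\<close> times the increment of the variation \<open>V\<close>. Such local
  bounds add up to \<open>\<Phi> b - \<Phi> a \<le> \<epsilon> (V b - V a)\<close>, with \<open>\<epsilon>\<close> arbitrary. This replaces
  Lebesgue-Stieltjes calculus.
\<close>

lemma nonpos_if_energy_decreases:
  fixes D :: "'i \<Rightarrow> real \<Rightarrow> real" and V :: "real \<Rightarrow> real" and w :: "'i \<Rightarrow> real"
  assumes ab: "a \<le> b" and J: "finite J" and w: "\<And>j. j \<in> J \<Longrightarrow> 0 \<le> w j"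
    and cont: "\<And>j. j \<in> J \<Longrightarrow> continuous_on {a..b} (D j)"
    and var: "\<And>j s t. j \<in> J \<Longrightarrow> a \<le> s \<Longrightarrow> s \<le> t \<Longrightarrow> t \<le> b \<Longrightarrow> \<bar>D j t - D j s\<bar> \<le> V t - V s"
    and descent: "\<And>y. y \<in> {a..b} \<Longrightarrow> \<forall>\<^sub>F t in at y within {a..b}.
        (y \<le> t \<longrightarrow> (\<Sum>j\<in>J. w j * max 0 (D j y) * (D j t - D j y)) \<le> 0) \<and>
        (t \<le> y \<longrightarrow> 0 \<le> (\<Sum>j\<in>J. w j * max 0 (D j y) * (D j t - D j y)))"
    and init: "\<And>j. j \<in> J \<Longrightarrow> D j a \<le> 0"
    and j: "j \<in> J" "0 < w j"
  shows "D j b \<le> 0"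
proof -
  define \<Phi> where "\<Phi> t = (\<Sum>j\<in>J. w j * (max 0 (D j t))\<^sup>2)" for t
  define W where "W = sum w J"
  have W: "0 < W"
    unfolding W_def using J w j by (intro sum_pos2[of _ j]) auto
  have convex_bound: "(max 0 v)\<^sup>2 - (max 0 u)\<^sup>2 \<le> 2 * max 0 v * (v - u)" for u v :: real
  proof -
    have "(max 0 v)\<^sup>2 - (max 0 u)\<^sup>2 = 2 * max 0 v * (max 0 v - max 0 u) - (max 0 v - max 0 u)\<^sup>2"
      by (simp add: power2_eq_square algebra_simps)
    also have "\<dots> \<le> 2 * max 0 v * (max 0 v - max 0 u)"
      by simp
    also have "\<dots> \<le> 2 * max 0 v * (v - u)"
      by (cases "0 < v") (auto intro!: mult_left_mono)
    finally show ?thesis .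
  qed
  have main: "\<Phi> b - \<Phi> a \<le> \<epsilon> * (V b - V a)" if \<epsilon>: "0 < \<epsilon>" for \<epsilon>
  proof -
    have "a \<le> a \<longrightarrow> b \<le> b \<longrightarrow> \<Phi> b - \<Phi> a \<le> \<epsilon> * (V b - V a)"
    proof (rule Bolzano[where P = "\<lambda>s t. a \<le> s \<longrightarrow> t \<le> b \<longrightarrow> \<Phi> t - \<Phi> s \<le> \<epsilon> * (V t - V s)"])
      fix s u t
      assume "a \<le> s \<longrightarrow> u \<le> b \<longrightarrow> \<Phi> u - \<Phi> s \<le> \<epsilon> * (V u - V s)"
        "a \<le> u \<longrightarrow> t \<le> b \<longrightarrow> \<Phi> t - \<Phi> u \<le> \<epsilon> * (V t - V u)" "s \<le> u" "u \<le> t"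
      then show "a \<le> s \<longrightarrow> t \<le> b \<longrightarrow> \<Phi> t - \<Phi> s \<le> \<epsilon> * (V t - V s)"
        by (auto simp: algebra_simps)
    next
      fix y assume "a \<le> y" "y \<le> b"
      then have y: "y \<in> {a..b}"
        by simp
      define \<eta> where "\<eta> = \<epsilon> / (2 * W)"
      have \<eta>: "0 < \<eta>" "2 * W * \<eta> = \<epsilon>"
        using \<epsilon> W by (auto simp: \<eta>_def)
      have "\<forall>\<^sub>F t in at y within {a..b}. \<forall>j\<in>J. dist (D j t) (D j y) < \<eta>"
        using J cont y \<eta> unfolding eventually_ball_finite_distrib[OF J]
        by (auto simp: continuous_on_def intro: tendstoD)
      with descent[OF y] have "\<forall>\<^sub>F t in at y within {a..b}.
          ((y \<le> t \<longrightarrow> (\<Sum>j\<in>J. w j * max 0 (D j y) * (D j t - D j y)) \<le> 0) \<and>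
           (t \<le> y \<longrightarrow> 0 \<le> (\<Sum>j\<in>J. w j * max 0 (D j y) * (D j t - D j y)))) \<and>
          (\<forall>j\<in>J. dist (D j t) (D j y) < \<eta>)"
        by (rule eventually_conj)
      then obtain d where d: "0 < d" and near_ne:
        "\<forall>t\<in>{a..b}. t \<noteq> y \<and> dist t y < d \<longrightarrow>
          ((y \<le> t \<longrightarrow> (\<Sum>j\<in>J. w j * max 0 (D j y) * (D j t - D j y)) \<le> 0) \<and>
           (t \<le> y \<longrightarrow> 0 \<le> (\<Sum>j\<in>J. w j * max 0 (D j y) * (D j t - D j y)))) \<and>
          (\<forall>j\<in>J. dist (D j t) (D j y) < \<eta>)"
        unfolding eventually_at by blast
      have near:
        "((y \<le> t \<longrightarrow> (\<Sum>j\<in>J. w j * max 0 (D j y) * (D j t - D j y)) \<le> 0) \<and>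
          (t \<le> y \<longrightarrow> 0 \<le> (\<Sum>j\<in>J. w j * max 0 (D j y) * (D j t - D j y)))) \<and>
          (\<forall>j\<in>J. dist (D j t) (D j y) < \<eta>)" if "t \<in> {a..b}" "dist t y < d" for t
        using near_ne that \<eta> by (cases "t = y") auto
      have "\<Phi> t - \<Phi> s \<le> \<epsilon> * (V t - V s)"
        if st: "a \<le> s" "s \<le> y" "y \<le> t" "t \<le> b" "t - s < d" for s t
      proof -
        have dist: "dist s y < d" "dist t y < d"
          using st by (auto simp: dist_real_def)
        have step: "w j * (max 0 (D j t))\<^sup>2 - w j * (max 0 (D j s))\<^sup>2
            \<le> 2 * (w j * max 0 (D j y) * (D j t - D j y)) - 2 * (w j * max 0 (D j y) * (D j s - D j y))
              + 2 * \<eta> * (V t - V s) * w j" if j: "j \<in> J" for j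
        proof -
          have close: "\<bar>max 0 (D j t) - max 0 (D j y)\<bar> \<le> \<eta>"
            using near[of t] dist st j by (auto simp: dist_real_def)
          have "(max 0 (D j t) - max 0 (D j y)) * (D j t - D j s)
              \<le> \<bar>max 0 (D j t) - max 0 (D j y)\<bar> * \<bar>D j t - D j s\<bar>"
            by (metis abs_ge_self abs_mult)
          also have "\<dots> \<le> \<eta> * (V t - V s)"
            using close var[of j s t] j st \<eta> by (intro mult_mono) auto
          finally have "(max 0 (D j t))\<^sup>2 - (max 0 (D j s))\<^sup>2
              \<le> 2 * (max 0 (D j y) * (D j t - D j s)) + 2 * (\<eta> * (V t - V s))"
            using convex_bound[of "D j t" "D j s"] by (simp add: algebra_simps)
          from mult_left_mono[OF this w[OF j]] show ?thesis
            by (simp add: algebra_simps)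
        qed
        have "\<Phi> t - \<Phi> s = (\<Sum>j\<in>J. w j * (max 0 (D j t))\<^sup>2 - w j * (max 0 (D j s))\<^sup>2)"
          by (simp add: \<Phi>_def sum_subtractf)
        also have "\<dots> \<le> (\<Sum>j\<in>J. 2 * (w j * max 0 (D j y) * (D j t - D j y))
            - 2 * (w j * max 0 (D j y) * (D j s - D j y)) + 2 * \<eta> * (V t - V s) * w j)"
          by (intro sum_mono step)
        also have "\<dots> = 2 * (\<Sum>j\<in>J. w j * max 0 (D j y) * (D j t - D j y))
            - 2 * (\<Sum>j\<in>J. w j * max 0 (D j y) * (D j s - D j y)) + 2 * \<eta> * (V t - V s) * W"
          by (simp add: sum.distrib sum_subtractf sum_distrib_left W_def)
        also have "\<dots> \<le> 2 * \<eta> * (V t - V s) * W"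
          using near[of t] near[of s] dist st by auto
        also have "\<dots> = (2 * W * \<eta>) * (V t - V s)"
          by (simp add: algebra_simps)
        also have "\<dots> = \<epsilon> * (V t - V s)"
          by (simp only: \<eta>(2))
        finally show ?thesis .
      qed
      with d show "\<exists>d>0. \<forall>s t. s \<le> y \<and> y \<le> t \<and> t - s < d \<longrightarrow>
          a \<le> s \<longrightarrow> t \<le> b \<longrightarrow> \<Phi> t - \<Phi> s \<le> \<epsilon> * (V t - V s)"
        by blast
    qed (fact ab)
    then show ?thesis by simp
  qed
  have "\<Phi> b - \<Phi> a \<le> 0"
  proof (rule ccontr)
    assume pos: "\<not> ?thesis"
    define \<epsilon> where "\<epsilon> = (\<Phi> b - \<Phi> a) / (2 * (\<bar>V b - V a\<bar> + 1))"
    have "0 < \<epsilon>"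
      using pos unfolding \<epsilon>_def
      by (intro divide_pos_pos mult_pos_pos add_nonneg_pos) auto
    have "\<Phi> b - \<Phi> a \<le> \<epsilon> * (V b - V a)"
      using main[OF \<open>0 < \<epsilon>\<close>] .
    also have "\<dots> \<le> \<epsilon> * (\<bar>V b - V a\<bar> + 1)"
      using \<open>0 < \<epsilon>\<close> by (intro mult_left_mono) auto
    also have "\<dots> = (\<Phi> b - \<Phi> a) / 2"
    proof -
      have "\<bar>V b - V a\<bar> + 1 \<noteq> 0"
        by linarith
      then show ?thesis
        unfolding \<epsilon>_def by (simp add: divide_simps)
    qed
    finally show False
      using pos by simp
  qed
  moreover have "\<Phi> a = 0"
    using init by (auto simp: \<Phi>_def intro!: sum.neutral)
  moreover have "w j * (max 0 (D j b))\<^sup>2 \<le> \<Phi> b"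
    unfolding \<Phi>_def using J w j by (intro member_le_sum) auto
  ultimately have "w j * (max 0 (D j b))\<^sup>2 \<le> 0"
    by simp
  then have "(max 0 (D j b))\<^sup>2 \<le> 0"
    using j(2) by (simp add: mult_le_0_iff)
  then show ?thesis
    by simp
qed

section \<open>Deterministic systems with collision local times\<close>

text \<open>
  A single path of the particle system, driven by \<open>w\<^sub>j(t) = x\<^sub>j + g\<^sub>j t + B\<^sub>j(t)\<close>. The condition on
  the Lebesgue-Stieltjes integral takes the elementary form \<open>flat\<close>: a local time is constant as long as
  its two particles stay apart.
\<close>

locale particle_path =
  fixes p :: real and w X L :: "nat \<Rightarrow> real \<Rightarrow> real"
  assumes X_cont: "1 \<le> j \<Longrightarrow> continuous_on {0..} (X j)"
    and L_cont: "continuous_on {0..} (L j)"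
    and X_eq: "0 \<le> t \<Longrightarrow> 1 \<le> j \<Longrightarrow> X j t = w j t + p * L (j - 1) t - (1 - p) * L j t"
    and L_bottom: "0 \<le> t \<Longrightarrow> L 0 t = 0"
    and L_init: "1 \<le> j \<Longrightarrow> L j 0 = 0"
    and L_mono: "1 \<le> j \<Longrightarrow> 0 \<le> s \<Longrightarrow> s \<le> t \<Longrightarrow> L j s \<le> L j t"
    and ordered: "0 \<le> t \<Longrightarrow> 1 \<le> j \<Longrightarrow> X j t \<le> X (Suc j) t"
    and flat: "1 \<le> j \<Longrightarrow> 0 \<le> s \<Longrightarrow> s \<le> t \<Longrightarrow> (\<And>r. r \<in> {s..t} \<Longrightarrow> X j r < X (Suc j) r)
      \<Longrightarrow> L j s = L j t"
begin

lemma L_mono': "0 \<le> s \<Longrightarrow> s \<le> t \<Longrightarrow> L j s \<le> L j t"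
  using L_mono[of j s t] L_bottom[of s] L_bottom[of t] by (cases j) auto

lemma L_locally_constant:
  assumes "1 \<le> j" "0 \<le> y" "X j y < X (Suc j) y"
  shows "\<forall>\<^sub>F t in at y within {0..}. L j t = L j y"
proof -
  have "continuous_on {0..} (\<lambda>t. X (Suc j) t - X j t)"
    using assms by (intro continuous_intros X_cont) auto
  then have "((\<lambda>t. X (Suc j) t - X j t) \<longlongrightarrow> X (Suc j) y - X j y) (at y within {0..})"
    using assms by (auto simp: continuous_on_def)
  then have "\<forall>\<^sub>F t in at y within {0..}. 0 < X (Suc j) t - X j t"
    using assms by (intro order_tendstoD(1)[where a = 0]) auto
  then obtain d where d: "0 < d"
    "\<And>t. t \<ge> 0 \<Longrightarrow> t \<noteq> y \<Longrightarrow> dist t y < d \<Longrightarrow> 0 < X (Suc j) t - X j t"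
    unfolding eventually_at by auto
  have apart: "X j t < X (Suc j) t" if "t \<ge> 0" "dist t y < d" for t
    using d(2)[of t] that assms by (cases "t = y") auto
  have "L j t = L j y" if t: "t \<ge> 0" "dist t y < d" for t
  proof (cases "t \<le> y")
    case True
    then show ?thesis
      using assms t by (intro flat apart) (auto simp: dist_real_def)
  next
    case False
    then show ?thesis
      using assms t by (intro flat[symmetric] apart) (auto simp: dist_real_def)
  qed
  then show ?thesis
    unfolding eventually_at using d(1) by auto
qed

text \<open>Constancy extends to the left endpoint, where the particles may still be in contact, because
  the local time is continuous.\<close>

lemma L_constant_after:
  assumes j: "1 \<le> j" and \<tau>: "0 \<le> \<tau>" and t: "\<tau> \<le> t"
    and apart: "\<And>r. \<tau> < r \<Longrightarrow> r \<le> t \<Longrightarrow> X j r < X (Suc j) r"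
  shows "L j t = L j \<tau>"
proof (cases "\<tau> = t")
  case False
  then have less: "\<tau> < t" using t by simp
  have "(L j \<longlongrightarrow> L j \<tau>) (at \<tau> within {0..})"
    using L_cont[of j] \<tau> by (auto simp: continuous_on_def)
  then have "(L j \<longlongrightarrow> L j \<tau>) (at \<tau> within {\<tau><..})"
    by (rule tendsto_within_subset) (use \<tau> in auto)
  moreover have "\<forall>\<^sub>F s in at_right \<tau>. L j s = L j t"
    using eventually_at_right_real[OF less]
  proof eventually_elim
    case (elim s)
    then show ?case
      using j \<tau> by (intro flat apart) auto
  qed
  then have "(L j \<longlongrightarrow> L j t) (at_right \<tau>)"
    by (rule tendsto_eventually)
  ultimately show ?thesis
    using tendsto_unique[of "at_right \<tau>"] by auto
qed auto

end

section \<open>Comparison of two systems with the same driving paths\<close>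

text \<open>Summation by parts for the weights \<open>q\<^sup>j p\<^sup>m\<^sup>-\<^sup>j\<close>, chosen so that the two pushes exerted by one
  local time have equal weight.\<close>

lemma weighted_push_sum:
  fixes p q :: real and c \<delta> :: "nat \<Rightarrow> real"
  assumes "1 \<le> m" "\<delta> 0 = 0"
  shows "(\<Sum>j=1..m. q ^ j * p ^ (m - j) * c j * (p * \<delta> (j - 1) - q * \<delta> j))
    = (\<Sum>j=1..<m. q ^ Suc j * p ^ (m - j) * ((c (Suc j) - c j) * \<delta> j)) - q ^ Suc m * (c m * \<delta> m)"
  using assms(1)
proof (induction m rule: dec_induct)
  case base
  then show ?case
    using assms(2) by simp
next
  case (step m)
  have shift: "(\<Sum>j=1..m. q ^ j * p ^ (Suc m - j) * c j * (p * \<delta> (j - 1) - q * \<delta> j))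
      = p * (\<Sum>j=1..m. q ^ j * p ^ (m - j) * c j * (p * \<delta> (j - 1) - q * \<delta> j))"
    unfolding sum_distrib_left by (intro sum.cong) (auto simp: Suc_diff_le)
  have shift': "(\<Sum>j=1..<m. q ^ Suc j * p ^ (Suc m - j) * ((c (Suc j) - c j) * \<delta> j))
      = p * (\<Sum>j=1..<m. q ^ Suc j * p ^ (m - j) * ((c (Suc j) - c j) * \<delta> j))"
    unfolding sum_distrib_left by (intro sum.cong) (auto simp: Suc_diff_le)
  have "(\<Sum>j=1..Suc m. q ^ j * p ^ (Suc m - j) * c j * (p * \<delta> (j - 1) - q * \<delta> j))
      = p * (\<Sum>j=1..m. q ^ j * p ^ (m - j) * c j * (p * \<delta> (j - 1) - q * \<delta> j))
        + q ^ Suc m * c (Suc m) * (p * \<delta> m - q * \<delta> (Suc m))"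
    using shift by simp
  also have "\<dots> = p * (\<Sum>j=1..<m. q ^ Suc j * p ^ (m - j) * ((c (Suc j) - c j) * \<delta> j))
        + q ^ Suc m * p * ((c (Suc m) - c m) * \<delta> m) - q ^ Suc (Suc m) * (c (Suc m) * \<delta> (Suc m))"
    unfolding step.IH by (simp add: algebra_simps)
  also have "\<dots> = (\<Sum>j=1..<Suc m. q ^ Suc j * p ^ (Suc m - j) * ((c (Suc j) - c j) * \<delta> j))
        - q ^ Suc (Suc m) * (c (Suc m) * \<delta> (Suc m))"
    using shift' step.hyps by (simp add: sum.atLeastLessThan_Suc)
  finally show ?case .
qed

locale coupled_particle_paths =
  X: particle_path p w X L + Y: particle_path p w Y M
  for p :: real and w X L Y M :: "nat \<Rightarrow> real \<Rightarrow> real" +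
  assumes p: "0 \<le> p" "p < 1"
begin

lemma difference_eq:
  assumes "0 \<le> t" "1 \<le> j"
  shows "Y j t - X j t = p * (M (j - 1) t - L (j - 1) t) - (1 - p) * (M j t - L j t)"
  using X.X_eq[OF assms] Y.X_eq[OF assms] by (simp add: algebra_simps)

text \<open>
  One step of the comparison principle. Particle \<open>m\<close> of \<open>X\<close> may be pushed from above, but only while
  it is not overtaken by that of \<open>Y\<close>; this makes the boundary term of the energy harmless.
\<close>

lemma comparison_top:
  assumes ab: "0 \<le> a" "a \<le> b" and m: "1 \<le> m"
    and init: "\<And>j. 1 \<le> j \<Longrightarrow> j \<le> m \<Longrightarrow> Y j a \<le> X j a"
    and top: "\<And>y. y \<in> {a..b} \<Longrightarrow> Y m y \<le> X m y \<or> (\<forall>\<^sub>F t in at y within {a..b}. L m t = L m y)"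
  shows "Y m b \<le> X m b"
proof -
  define D where "D j t = Y j t - X j t" for j t
  define q where "q = 1 - p"
  have q: "0 < q" using p by (simp add: q_def)
  define V where "V t = (\<Sum>i\<le>m. L i t + M i t)" for t
  have "D m b \<le> 0"
  proof (rule nonpos_if_energy_decreases[where D = D and j = m and a = a and b = b and J = "{1..m}" and V = V
        and w = "\<lambda>j. q ^ j * p ^ (m - j)"])
    show "continuous_on {a..b} (D j)" if "j \<in> {1..m}" for j
      unfolding D_def using that ab
      by (intro continuous_on_diff continuous_on_subset[OF X.X_cont]
          continuous_on_subset[OF Y.X_cont]) auto
    show "\<bar>D j t - D j s\<bar> \<le> V t - V s"
      if j: "j \<in> {1..m}" and st: "a \<le> s" "s \<le> t" "t \<le> b" for j s t
    proof -
      have one: "\<bar>(M i t - L i t) - (M i s - L i s)\<bar> \<le> V t - V s" if "i \<le> m" for i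
      proof -
        have nonneg: "0 \<le> (L i t + M i t) - (L i s + M i s)" for i
          using X.L_mono'[of s t i] Y.L_mono'[of s t i] st ab by auto
        have "\<bar>(M i t - L i t) - (M i s - L i s)\<bar> \<le> (L i t + M i t) - (L i s + M i s)"
          using X.L_mono'[of s t i] Y.L_mono'[of s t i] st ab by auto
        also have "\<dots> \<le> (\<Sum>i\<le>m. (L i t + M i t) - (L i s + M i s))"
          using that nonneg by (intro member_le_sum) auto
        also have "\<dots> = V t - V s"
          by (simp add: V_def sum_subtractf)
        finally show ?thesis .
      qed
      have "D j t - D j s = p * ((M (j - 1) t - L (j - 1) t) - (M (j - 1) s - L (j - 1) s))
          - q * ((M j t - L j t) - (M j s - L j s))"
        using difference_eq[of t j] difference_eq[of s j] j st ab
        by (simp add: D_def q_def algebra_simps)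
      also have "\<bar>\<dots>\<bar> \<le> p * \<bar>(M (j - 1) t - L (j - 1) t) - (M (j - 1) s - L (j - 1) s)\<bar>
          + q * \<bar>(M j t - L j t) - (M j s - L j s)\<bar>"
        using p q by (intro order_trans[OF abs_triangle_ineq4]) (simp add: abs_mult)
      also have "\<dots> \<le> p * (V t - V s) + q * (V t - V s)"
        using p q j by (intro add_mono mult_left_mono one) auto
      also have "\<dots> = V t - V s"
        by (simp add: q_def algebra_simps)
      finally show ?thesis .
    qed
    show "\<forall>\<^sub>F t in at y within {a..b}.
        (y \<le> t \<longrightarrow> (\<Sum>j=1..m. q ^ j * p ^ (m - j) * max 0 (D j y) * (D j t - D j y)) \<le> 0) \<and>
        (t \<le> y \<longrightarrow> 0 \<le> (\<Sum>j=1..m. q ^ j * p ^ (m - j) * max 0 (D j y) * (D j t - D j y)))"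
      if y: "y \<in> {a..b}" for y
    proof -
      define c where "c j = max 0 (D j y)" for j
      have within: "at y within {a..b} \<le> at y within {0..}"
        using ab by (intro at_le) auto
      have "\<forall>\<^sub>F t in at y within {a..b}. X j y < X (Suc j) y \<longrightarrow> L j t = L j y"
        if "j \<in> {1..<m}" for j
        using X.L_locally_constant[of j y] that y ab filter_leD[OF within]
        by (cases "X j y < X (Suc j) y") auto
      moreover have "\<forall>\<^sub>F t in at y within {a..b}. Y j y < Y (Suc j) y \<longrightarrow> M j t = M j y"
        if "j \<in> {1..<m}" for j
        using Y.L_locally_constant[of j y] that y ab filter_leD[OF within]
        by (cases "Y j y < Y (Suc j) y") auto
      ultimately have ev1: "\<forall>\<^sub>F t in at y within {a..b}. \<forall>j\<in>{1..<m}.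
          (X j y < X (Suc j) y \<longrightarrow> L j t = L j y) \<and> (Y j y < Y (Suc j) y \<longrightarrow> M j t = M j y)"
        by (intro eventually_ball_finite ballI eventually_conj) auto
      have ev2: "\<forall>\<^sub>F t in at y within {a..b}. Y m y \<le> X m y \<or> L m t = L m y"
        using top[OF y] by (auto elim: eventually_mono)
      have ev3: "\<forall>\<^sub>F t in at y within {a..b}. t \<in> {a..b}"
        by (simp add: eventually_at_filter)
      from ev1 ev2 ev3 show ?thesis
      proof eventually_elim
        case (elim t)
        define \<delta> where "\<delta> j = (M j t - L j t) - (M j y - L j y)" for j
        have "D j t - D j y = p * \<delta> (j - 1) - q * \<delta> j" if "j \<in> {1..m}" for j
          using difference_eq[of t j] difference_eq[of y j] elim y ab that
          by (simp add: D_def \<delta>_def q_def algebra_simps)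
        then have "(\<Sum>j=1..m. q ^ j * p ^ (m - j) * max 0 (D j y) * (D j t - D j y))
            = (\<Sum>j=1..m. q ^ j * p ^ (m - j) * c j * (p * \<delta> (j - 1) - q * \<delta> j))"
          by (intro sum.cong refl) (simp add: c_def)
        also have "\<dots> = (\<Sum>j=1..<m. q ^ Suc j * p ^ (m - j) * ((c (Suc j) - c j) * \<delta> j))
            - q ^ Suc m * (c m * \<delta> m)"
          using m elim y ab by (intro weighted_push_sum) (auto simp: \<delta>_def X.L_bottom Y.L_bottom)
        finally have eq: "(\<Sum>j=1..m. q ^ j * p ^ (m - j) * max 0 (D j y) * (D j t - D j y)) = \<dots>" .
        \<comment> \<open>The collision at time \<open>y\<close> that lets \<open>M j\<close> (or \<open>L j\<close>) grow fixes the sign of its factor.\<close>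
        have M_or: "c (Suc j) \<le> c j \<or> M j t = M j y" if "j \<in> {1..<m}" for j
          using elim that Y.ordered[of y j] X.ordered[of y j] y ab
          by (cases "Y j y < Y (Suc j) y") (auto simp: c_def D_def)
        have L_or: "c j \<le> c (Suc j) \<or> L j t = L j y" if "j \<in> {1..<m}" for j
          using elim that Y.ordered[of y j] X.ordered[of y j] y ab
          by (cases "X j y < X (Suc j) y") (auto simp: c_def D_def)
        have c_nonneg: "0 \<le> c j" for j
          by (simp add: c_def)
        have L_top: "c m = 0 \<or> L m t = L m y"
          using elim by (auto simp: c_def D_def)
        show ?case
        proof (intro conjI impI)
          assume le: "y \<le> t"
          have grow: "L j y \<le> L j t" "M j y \<le> M j t" for j
            using X.L_mono'[of y t j] Y.L_mono'[of y t j] le y ab by auto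
          have "(c (Suc j) - c j) * \<delta> j \<le> 0" if "j \<in> {1..<m}" for j
            using M_or[OF that] L_or[OF that] grow[of j]
            by (auto simp: \<delta>_def mult_le_0_iff)
          then have "(\<Sum>j=1..<m. q ^ Suc j * p ^ (m - j) * ((c (Suc j) - c j) * \<delta> j)) \<le> 0"
            using p q by (intro sum_nonpos) (simp add: mult_nonneg_nonpos)
          moreover have "0 \<le> q ^ Suc m * (c m * \<delta> m)"
            using q L_top grow[of m] c_nonneg[of m] by (auto simp: \<delta>_def)
          ultimately show "(\<Sum>j=1..m. q ^ j * p ^ (m - j) * max 0 (D j y) * (D j t - D j y)) \<le> 0"
            unfolding eq by linarith
        next
          assume le: "t \<le> y"
          have grow: "L j t \<le> L j y" "M j t \<le> M j y" for j
            using X.L_mono'[of t y j] Y.L_mono'[of t y j] le elim ab by auto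
          have "0 \<le> (c (Suc j) - c j) * \<delta> j" if "j \<in> {1..<m}" for j
            using M_or[OF that] L_or[OF that] grow[of j]
            by (auto simp: \<delta>_def zero_le_mult_iff)
          then have "0 \<le> (\<Sum>j=1..<m. q ^ Suc j * p ^ (m - j) * ((c (Suc j) - c j) * \<delta> j))"
            using p q by (intro sum_nonneg) simp
          moreover have "c m * \<delta> m \<le> 0"
            using L_top grow[of m] c_nonneg[of m] by (auto simp: \<delta>_def mult_le_0_iff)
          then have "q ^ Suc m * (c m * \<delta> m) \<le> 0"
            using q mult_nonneg_nonpos[of "q ^ Suc m"] by simp
          ultimately show "0 \<le> (\<Sum>j=1..m. q ^ j * p ^ (m - j) * max 0 (D j y) * (D j t - D j y))"
            unfolding eq by linarith
        qed
      qed
    qed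
  qed (use ab m p q init in \<open>auto simp: D_def\<close>)
  then show ?thesis
    by (simp add: D_def)
qed

text \<open>
  Descending from particle \<open>n\<close>: once particle \<open>m + 1\<close> is known not to be overtaken, neither is particle
  \<open>m\<close> at a time at which \<open>L\<^sub>m\<close> grows, since then \<open>Y\<^sub>m \<le> Y\<^sub>m\<^sub>+\<^sub>1 \<le> X\<^sub>m\<^sub>+\<^sub>1 = X\<^sub>m\<close>. The descent is
  needed for \<open>p = 0\<close>, where the weight \<open>q\<^sup>j p\<^sup>m\<^sup>-\<^sup>j\<close> is positive only for \<open>j = m\<close>.
\<close>

lemma comparison:
  assumes a: "0 \<le> a"
    and init: "\<And>j. 1 \<le> j \<Longrightarrow> j \<le> n \<Longrightarrow> Y j a \<le> X j a"
    and free: "\<And>t. t \<in> {a..b} \<Longrightarrow> L n t = L n a"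
    and m: "1 \<le> m" "m \<le> n" and t: "t \<in> {a..b}"
  shows "Y m t \<le> X m t"
  using m(2) m(1) t
proof (induction m arbitrary: t rule: inc_induct)
  case base
  show ?case
  proof (rule comparison_top)
    fix y assume y: "y \<in> {a..t}"
    have "L n s = L n y" if "s \<in> {a..t}" for s
      using free[of s] free[of y] that y base by simp
    then show "Y n y \<le> X n y \<or> (\<forall>\<^sub>F s in at y within {a..t}. L n s = L n y)"
      by (simp add: eventually_at_filter)
  qed (use a base init in auto)
next
  case (step m)
  show ?case
  proof (rule comparison_top)
    fix y assume y: "y \<in> {a..t}"
    have above: "Y (Suc m) y \<le> X (Suc m) y"
      using step y by auto
    show "Y m y \<le> X m y \<or> (\<forall>\<^sub>F s in at y within {a..t}. L m s = L m y)"
    proof (cases "X m y < X (Suc m) y")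
      case True
      have "at y within {a..t} \<le> at y within {0..}"
        using a by (intro at_le) auto
      then show ?thesis
        using X.L_locally_constant[of m y] True y a step.prems filter_leD by auto
    next
      case False
      then show ?thesis
        using above Y.ordered[of y m] y a step.prems by auto
    qed
  qed (use a step init in auto)
qed

end

section \<open>Collision chains\<close>

definition collision_chain :: "nat \<Rightarrow> nat \<Rightarrow> real set \<Rightarrow> (nat \<Rightarrow> real \<Rightarrow> real) \<Rightarrow> bool" where
  "collision_chain i k I X \<longleftrightarrow> (\<exists>s. antimono_on {i..<i + k} s \<and>
     (\<forall>j\<in>{i..<i + k}. s j \<in> I \<and> X (j + 1) (s j) = X j (s j)))"

lemma collision_chain_subset: "collision_chain i k I X \<Longrightarrow> I \<subseteq> I' \<Longrightarrow> collision_chain i k I' X"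
  unfolding collision_chain_def by blast

lemma collision_chain_Suc:
  assumes chain: "collision_chain (Suc i) k {a..\<tau>} X"
    and \<tau>: "\<tau> \<in> {a..b}" "X (Suc i) \<tau> = X i \<tau>"
  shows "collision_chain i (Suc k) {a..b} X"
proof -
  obtain s where s: "antimono_on {Suc i..<Suc i + k} s"
    "\<And>j. j \<in> {Suc i..<Suc i + k} \<Longrightarrow> s j \<in> {a..\<tau>} \<and> X (j + 1) (s j) = X j (s j)"
    using chain by (auto simp: collision_chain_def)
  have s_less: "s j \<le> \<tau>" if "Suc i \<le> j" "j < Suc (i + k)" for j
    using s(2)[of j] that by auto
  have "antimono_on {i..<i + Suc k} (s(i := \<tau>))"
    using s(1) s_less by (auto simp: monotone_on_def)
  moreover have "(s(i := \<tau>)) j \<in> {a..b} \<and> X (j + 1) ((s(i := \<tau>)) j) = X j ((s(i := \<tau>)) j)"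
    if "j \<in> {i..<i + Suc k}" for j
    using s(2)[of j] \<tau> that by (cases "j = i") auto
  ultimately show ?thesis
    unfolding collision_chain_def by blast
qed

lemma Kstar_finite_imp_no_chain:
  assumes "Kstar i I X < \<infinity>"
  obtains k where "\<not> collision_chain i k I X"
proof (rule ccontr)
  assume "\<not> thesis"
  then have all: "collision_chain i k I X" for k
    using that by blast
  have "enat k \<le> Kstar i I X" for k
    unfolding Kstar_def using all[of k] unfolding collision_chain_def by (intro Sup_upper) blast
  moreover obtain n where "Kstar i I X = enat n"
    using assms by (cases "Kstar i I X") auto
  ultimately have "enat (Suc n) \<le> enat n"
    by metis
  then show False
    by simp
qed

lemma Kstar_mono: "I \<subseteq> I' \<Longrightarrow> Kstar i I X \<le> Kstar i I' X"
  unfolding Kstar_def by (rule Sup_subset_mono) blast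

context coupled_particle_paths
begin

text \<open>Going back from \<open>b\<close> to the last collision of particles \<open>i\<close> and \<open>i + 1\<close> of \<open>X\<close> shortens the chains
  by one; after that collision the \<open>i\<close> lowest particles of \<open>X\<close> receive no push from above.\<close>

lemma comparison_without_chain:
  assumes a: "0 \<le> a" and init: "\<And>j. 1 \<le> j \<Longrightarrow> Y j a \<le> X j a"
    and "\<not> collision_chain i k {a..b} X" "1 \<le> i" "a \<le> b" "1 \<le> j" "j \<le> i"
  shows "Y j b \<le> X j b"
  using assms(3-)
proof (induction k arbitrary: i j b)
  case 0
  then show ?case
    by (simp add: collision_chain_def monotone_on_def)
next
  case (Suc k)
  define C where "C = {s \<in> {a..b}. X (Suc i) s - X i s = 0}"
  show ?case
  proof (cases "C = {}")
    case True
    have apart: "X i r < X (Suc i) r" if "r \<in> {a..b}" for r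
    proof -
      have "r \<notin> C"
        using True by simp
      then have "X i r \<noteq> X (Suc i) r"
        using that by (simp add: C_def)
      then show ?thesis
        using that X.ordered[of r i] Suc.prems(2) a by simp
    qed
    have free: "L i t = L i a" if "t \<in> {a..b}" for t
      using that apart Suc.prems a by (intro X.L_constant_after) auto
    show ?thesis
      by (rule comparison[OF a init free]) (use Suc.prems in auto)
  next
    case False
    have "continuous_on {a..b} (\<lambda>s. X (Suc i) s - X i s)"
      using Suc.prems a
      by (intro continuous_intros continuous_on_subset[OF X.X_cont]) auto
    then have "closed C"
      unfolding C_def by (intro continuous_closed_preimage_constant) auto
    moreover have "bdd_above C"
      by (auto simp: C_def bdd_above_def)
    ultimately have Sup_in: "Sup C \<in> C"
      using False by (intro closed_contains_Sup) auto
    define \<tau> where "\<tau> = Sup C"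
    have \<tau>: "\<tau> \<in> {a..b}" "X (Suc i) \<tau> = X i \<tau>"
      using Sup_in by (auto simp: \<tau>_def C_def)
    have "\<not> collision_chain (Suc i) k {a..\<tau>} X"
      using collision_chain_Suc \<tau> Suc.prems(1) by blast
    then have at_\<tau>: "Y j \<tau> \<le> X j \<tau>" if "1 \<le> j" "j \<le> i" for j
      using Suc.IH[of "Suc i" \<tau> j] \<tau> that by auto
    have apart: "X i r < X (Suc i) r" if "\<tau> < r" "r \<le> b" for r
    proof -
      have "r \<notin> C"
        using that cSup_upper[of r C] \<open>bdd_above C\<close> by (auto simp: \<tau>_def)
      then have "X i r \<noteq> X (Suc i) r"
        using that \<tau> by (simp add: C_def)
      then show ?thesis
        using that X.ordered[of r i] Suc.prems(2) a \<tau>(1) by simp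
    qed
    have free: "L i t = L i \<tau>" if "t \<in> {\<tau>..b}" for t
      using that apart Suc.prems \<tau> a by (intro X.L_constant_after) auto
    show ?thesis
      by (rule comparison[OF _ at_\<tau> free]) (use a \<tau> Suc.prems in auto)
  qed
qed

end

lemma coupled_paths_eq_on_window:
  assumes XY: "coupled_particle_paths p w X L Y M" and r: "0 \<le> r"
    and eq: "\<And>j. 1 \<le> j \<Longrightarrow> X j r = Y j r"
    and fin: "\<And>i. 1 \<le> i \<Longrightarrow> Kstar i {r..u} X < \<infinity>" "\<And>i. 1 \<le> i \<Longrightarrow> Kstar i {r..u} Y < \<infinity>"
    and t: "t \<in> {r..u}" and j: "1 \<le> j"
  shows "X j t = Y j t"
proof -
  have YX: "coupled_particle_paths p w Y M X L"
    using XY by (simp add: coupled_particle_paths_def coupled_particle_paths_axioms_def)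
  obtain k where "\<not> collision_chain j k {r..u} X"
    using Kstar_finite_imp_no_chain[OF fin(1)[OF j]] .
  then have "\<not> collision_chain j k {r..t} X"
    using collision_chain_subset[of j k "{r..t}" X "{r..u}"] t by auto
  then have "Y j t \<le> X j t"
    using coupled_particle_paths.comparison_without_chain[OF XY r, of j k t j] eq t j by auto
  moreover obtain k' where "\<not> collision_chain j k' {r..u} Y"
    using Kstar_finite_imp_no_chain[OF fin(2)[OF j]] .
  then have "\<not> collision_chain j k' {r..t} Y"
    using collision_chain_subset[of j k' "{r..t}" Y "{r..u}"] t by auto
  then have "X j t \<le> Y j t"
    using coupled_particle_paths.comparison_without_chain[OF YX r, of j k' t j] eq t j by auto
  ultimately show ?thesis
    by simp
qed

text \<open>Equality up to time \<open>n \<delta>/2\<close> passes to \<open>(n + 1) \<delta>/2\<close> through a window that starts at a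
  rational time within \<open>\<delta>/2\<close> before \<open>n \<delta>/2\<close>.\<close>

lemma coupled_paths_eq:
  assumes XY: "coupled_particle_paths p w X L Y M" and \<delta>: "0 < \<delta>"
    and fin: "\<And>i r. 1 \<le> i \<Longrightarrow> r \<in> \<rat> \<Longrightarrow> 0 \<le> r \<Longrightarrow> Kstar i {r..r + \<delta>} X < \<infinity>"
      "\<And>i r. 1 \<le> i \<Longrightarrow> r \<in> \<rat> \<Longrightarrow> 0 \<le> r \<Longrightarrow> Kstar i {r..r + \<delta>} Y < \<infinity>"
    and t: "0 \<le> t" and j: "1 \<le> j"
  shows "X j t = Y j t"
proof -
  interpret coupled_particle_paths p w X L Y M by (fact XY)
  have upto: "\<forall>t j. 0 \<le> t \<longrightarrow> t \<le> n * (\<delta> / 2) \<longrightarrow> 1 \<le> j \<longrightarrow> X j t = Y j t" for n :: nat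
  proof (induction n)
    case 0
    have zero: "L i 0 = 0 \<and> M i 0 = 0" for i
    proof (cases "i = 0")
      case True
      then show ?thesis
        using X.L_bottom[of 0] Y.L_bottom[of 0] by simp
    next
      case False
      then show ?thesis
        using X.L_init[of i] Y.L_init[of i] by simp
    qed
    have "X j 0 = Y j 0" if "1 \<le> j" for j
      using difference_eq[of 0 j] that zero[of j] zero[of "j - 1"] by simp
    moreover have "t = 0" if "0 \<le> t" "t \<le> real 0 * (\<delta> / 2)" for t
      using that by simp
    ultimately show ?case
      by blast
  next
    case (Suc n)
    have "\<exists>r\<in>\<rat>. 0 \<le> r \<and> r \<le> n * (\<delta> / 2) \<and> n * (\<delta> / 2) < r + \<delta> / 2"
    proof (cases "n = 0")
      case False
      then have "max 0 (n * (\<delta> / 2) - \<delta> / 2) < n * (\<delta> / 2)"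
        using \<delta> by auto
      from Rats_dense_in_real[OF this] show ?thesis
        by force
    qed (use \<delta> in auto)
    then obtain r where r: "r \<in> \<rat>" "0 \<le> r" "r \<le> n * (\<delta> / 2)" "n * (\<delta> / 2) < r + \<delta> / 2"
      by blast
    have "X j t = Y j t" if "0 \<le> t" "t \<le> Suc n * (\<delta> / 2)" "1 \<le> j" for t j
    proof (cases "t \<le> r")
      case True
      then show ?thesis
        using Suc.IH that r by auto
    next
      case False
      then have "t \<in> {r..r + \<delta>}"
        using that r by (auto simp: algebra_simps)
      then show ?thesis
        using coupled_paths_eq_on_window[OF XY r(2) _ fin(1)[OF _ r(1,2)] fin(2)[OF _ r(1,2)]]
          Suc.IH r that by auto
    qed
    then show ?case
      by blast
  qed
  obtain n :: nat where "t / (\<delta> / 2) \<le> n"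
    using real_arch_simple by blast
  then have "t \<le> n * (\<delta> / 2)"
    using \<delta> by (simp add: field_simps)
  then show ?thesis
    using upto t j by blast
qed

section \<open>Paths of competing Brownian particles\<close>

text \<open>If the gap \<open>h\<close> is bounded below by \<open>c > 0\<close> on \<open>[s, t]\<close>, its integral is at least
  \<open>c (L t - L s)\<close>.\<close>

lemma constant_if_stieltjes_integral_0:
  fixes L h :: "real \<Rightarrow> real"
  assumes L: "continuous_on {0..} L" "mono_on {0..} L" and h: "continuous_on {0..} h"
    and int: "(\<integral>\<^sup>+r\<in>{0..}. ennreal (h r) \<partial>interval_measure (\<lambda>r. L (max 0 r))) = 0"
    and st: "0 \<le> s" "s \<le> t" and pos: "\<And>r. r \<in> {s..t} \<Longrightarrow> 0 < h r"
  shows "L s = L t"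
proof -
  let ?\<mu> = "interval_measure (\<lambda>r. L (max 0 r))"
  have mono: "L (max 0 u) \<le> L (max 0 v)" if "u \<le> v" for u v
    using L(2) that by (intro mono_onD[OF L(2)]) auto
  have "continuous_on UNIV (\<lambda>r. L (max 0 r))"
    by (rule continuous_on_compose2[OF L(1)]) (auto intro!: continuous_intros)
  then have right_cont: "continuous (at_right u) (\<lambda>r. L (max 0 r))" for u
    by (metis UNIV_I continuous_at_imp_continuous_at_within continuous_on_eq_continuous_at open_UNIV)
  have "continuous_on {s..t} h"
    using st by (intro continuous_on_subset[OF h]) auto
  then obtain z where z: "z \<in> {s..t}" "\<And>r. r \<in> {s..t} \<Longrightarrow> h z \<le> h r"
    using continuous_attains_inf[of "{s..t}" h] st by auto
  have "ennreal (h z) * ennreal (L t - L s) = ennreal (h z) * emeasure ?\<mu> {s<..t}"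
    using emeasure_interval_measure_Ioc[OF st(2) mono right_cont] st by simp
  also have "\<dots> = (\<integral>\<^sup>+r. ennreal (h z) * indicator {s<..t} r \<partial>?\<mu>)"
    by (simp add: nn_integral_cmult_indicator)
  also have "\<dots> \<le> (\<integral>\<^sup>+r\<in>{0..}. ennreal (h r) \<partial>?\<mu>)"
    using st z by (intro nn_integral_mono) (auto simp: indicator_def intro: ennreal_leI)
  also have "\<dots> = 0"
    by (fact int)
  finally have "L t - L s \<le> 0"
    using pos[OF z(1)] by (simp add: ennreal_eq_0_iff)
  then show ?thesis
    using mono_onD[OF L(2), of s t] st by auto
qed

lemma competing_brownian_particles_path:
  assumes "competing_brownian_particles M F p g x B X"
  shows "\<exists>L. AE \<omega> in M. particle_path p (\<lambda>j t. x j \<omega> + g j * t + B j t \<omega>)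
    (\<lambda>j t. X j t \<omega>) (\<lambda>j t. L j t \<omega>)"
proof -
  from assms obtain L where L: "local_times M F p g x B X L"
    and X: "\<And>j. 1 \<le> j \<Longrightarrow> continuous_process M (X j)"
    and ordered: "AE \<omega> in M. \<forall>t\<ge>0. mono_on {1..} (\<lambda>j. X j t \<omega>)"
    unfolding competing_brownian_particles_def by blast
  have X_cont: "AE \<omega> in M. \<forall>j. 1 \<le> j \<longrightarrow> continuous_on {0..} (\<lambda>t. X j t \<omega>)"
    using X by (auto simp: AE_all_countable continuous_process_def)
  have L_cont: "AE \<omega> in M. \<forall>j. continuous_on {0..} (\<lambda>t. L j t \<omega>)"
    using L by (auto simp: AE_all_countable continuous_process_def local_times_def)
  have L_props:
    "AE \<omega> in M. \<forall>t\<ge>0. \<forall>j\<ge>1.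
        X j t \<omega> = x j \<omega> + g j * t + B j t \<omega> + p * L (j - 1) t \<omega> - (1 - p) * L j t \<omega>"
    "AE \<omega> in M. \<forall>t\<ge>0. L 0 t \<omega> = 0"
    "AE \<omega> in M. \<forall>j\<ge>1. mono_on {0..} (\<lambda>t. L j t \<omega>) \<and> L j 0 \<omega> = 0"
    "AE \<omega> in M. \<forall>j\<ge>1. (\<integral>\<^sup>+t\<in>{0..}. ennreal (X (j + 1) t \<omega> - X j t \<omega>)
        \<partial>interval_measure (\<lambda>t. L j (max 0 t) \<omega>)) = 0"
    using L unfolding local_times_def by blast+
  from ordered X_cont L_cont L_props have "AE \<omega> in M. particle_path p
      (\<lambda>j t. x j \<omega> + g j * t + B j t \<omega>) (\<lambda>j t. X j t \<omega>) (\<lambda>j t. L j t \<omega>)"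
  proof eventually_elim
    case (elim \<omega>)
    show ?case
    proof
      show "L j s \<omega> = L j t \<omega>" if j: "1 \<le> j" and st: "0 \<le> s" "s \<le> t"
        and apart: "\<And>r. r \<in> {s..t} \<Longrightarrow> X j r \<omega> < X (Suc j) r \<omega>" for j s t
      proof (rule constant_if_stieltjes_integral_0[where L = "\<lambda>t. L j t \<omega>"
            and h = "\<lambda>t. X (j + 1) t \<omega> - X j t \<omega>"])
        show "continuous_on {0..} (\<lambda>t. X (j + 1) t \<omega> - X j t \<omega>)"
          using elim(2) j by (intro continuous_on_diff) auto
      qed (use elim(3,6,7) j st apart in auto)
    next
      show "X j t \<omega> \<le> X (Suc j) t \<omega>" if "0 \<le> t" "1 \<le> j" for j t
        using elim(1) that by (auto intro: mono_onD[of "{1..}" "\<lambda>j. X j t \<omega>"])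
    next
      show "L j s \<omega> \<le> L j t \<omega>" if "1 \<le> j" "0 \<le> s" "s \<le> t" for j s t
        using elim(6) that by (auto intro: mono_onD[of "{0..}" "\<lambda>t. L j t \<omega>"])
    qed (use elim in auto)
  qed
  then show ?thesis
    by (rule exI[where x = L])
qed

text \<open>Both alternatives reduce to one almost sure statement about windows that start at rational
  times: finiteness on \<open>[0, r + 1]\<close> gives finiteness on \<open>[r, r + 1]\<close>.\<close>

theorem lemma3p3:
  fixes M :: "'a measure" and F :: "real \<Rightarrow> 'a measure"
    and B :: "nat \<Rightarrow> real \<Rightarrow> 'a \<Rightarrow> real" and x :: "nat \<Rightarrow> 'a \<Rightarrow> real"
    and p :: real and g :: "nat \<Rightarrow> real"
    and X1 X2 :: "nat \<Rightarrow> real \<Rightarrow> 'a \<Rightarrow> real"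
  assumes "cbp_setting M F B x"
    and "0 \<le> p" and "p < 1"
    and "competing_brownian_particles M F p g x B X1"
    and "competing_brownian_particles M F p g x B X2"
    and "(\<forall>X\<in>{X1, X2}. \<forall>i\<ge>1. \<forall>T>0.
            AE \<omega> in M. Kstar i {0..T} (\<lambda>j t. X j t \<omega>) < \<infinity>)
         \<or> (\<exists>\<Delta>\<in>borel_measurable (F 0). (AE \<omega> in M. 0 < \<Delta> \<omega>) \<and>
              (\<forall>X\<in>{X1, X2}. \<forall>i\<ge>1. \<forall>T\<ge>0.
                 AE \<omega> in M. Kstar i {T..T + \<Delta> \<omega>} (\<lambda>j t. X j t \<omega>) < \<infinity>))"
  shows "AE \<omega> in M. \<forall>t\<ge>0. \<forall>j\<ge>1. X1 j t \<omega> = X2 j t \<omega>"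
proof -
  obtain L1 where path1: "AE \<omega> in M. particle_path p (\<lambda>j t. x j \<omega> + g j * t + B j t \<omega>)
      (\<lambda>j t. X1 j t \<omega>) (\<lambda>j t. L1 j t \<omega>)"
    using competing_brownian_particles_path[OF assms(4)] by blast
  obtain L2 where path2: "AE \<omega> in M. particle_path p (\<lambda>j t. x j \<omega> + g j * t + B j t \<omega>)
      (\<lambda>j t. X2 j t \<omega>) (\<lambda>j t. L2 j t \<omega>)"
    using competing_brownian_particles_path[OF assms(5)] by blast
  obtain \<Delta> where \<Delta>: "AE \<omega> in M. 0 < \<Delta> \<omega>"
    and window: "\<And>X i r. X \<in> {X1, X2} \<Longrightarrow> 1 \<le> i \<Longrightarrow> 0 \<le> r \<Longrightarrow>
      AE \<omega> in M. Kstar i {r..r + \<Delta> \<omega>} (\<lambda>j t. X j t \<omega>) < \<infinity>"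
    using assms(6)
  proof (elim disjE bexE conjE)
    assume a: "\<forall>X\<in>{X1, X2}. \<forall>i\<ge>1. \<forall>T>0. AE \<omega> in M. Kstar i {0..T} (\<lambda>j t. X j t \<omega>) < \<infinity>"
    have "AE \<omega> in M. Kstar i {r..r + 1} (\<lambda>j t. X j t \<omega>) < \<infinity>"
      if "X \<in> {X1, X2}" "1 \<le> i" "0 \<le> r" for X i and r :: real
    proof -
      have "AE \<omega> in M. Kstar i {0..r + 1} (\<lambda>j t. X j t \<omega>) < \<infinity>"
        using a that by force
      then show ?thesis
      proof eventually_elim
        case (elim \<omega>)
        have "{r..r + 1} \<subseteq> {0..r + 1}"
          using that by auto
        then show ?case
          by (rule le_less_trans[OF Kstar_mono elim])
      qed
    qed
    then show thesis
      using that[of "\<lambda>_. 1"] by auto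
  qed (use that in blast)
  have windows: "AE \<omega> in M. \<forall>r\<in>\<rat>. \<forall>i. 1 \<le> i \<longrightarrow> 0 \<le> r \<longrightarrow>
      Kstar i {r..r + \<Delta> \<omega>} (\<lambda>j t. X j t \<omega>) < \<infinity>" if "X \<in> {X1, X2}" for X
    using window[OF that]
    by (auto simp: AE_ball_countable[OF countable_rat] AE_all_countable)
  from path1 path2 \<Delta> windows[of X1, simplified] windows[of X2, simplified] show ?thesis
  proof eventually_elim
    case (elim \<omega>)
    have "coupled_particle_paths p (\<lambda>j t. x j \<omega> + g j * t + B j t \<omega>)
        (\<lambda>j t. X1 j t \<omega>) (\<lambda>j t. L1 j t \<omega>) (\<lambda>j t. X2 j t \<omega>) (\<lambda>j t. L2 j t \<omega>)"
      using elim assms(2,3)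
      by (simp add: coupled_particle_paths_def coupled_particle_paths_axioms_def)
    from coupled_paths_eq[OF this elim(3)] show ?case
      using elim(4,5) by auto
  qed
qed

end
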